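(* Let $\mathbb{G}$ be a nice group that acts linearly and continuously on a locally convex Hausdorff topological vector space $X$. Let $(\mathbf{A}_n)_{n\in\mathbb{N}}$ be a Følner sequence in $\mathbb{G}$, and let $x\in X$. Then the following hold. (i) If the orbitope $\Pi(x)$ is compact, it contains a $\mathbb{G}$-invariant element $\bar{x}$ that satisfies $$f(\bar{x})\;\leq\;\sup_{\phi\in\mathbb{G}}f(\phi(x))\qquad\text{for every convex lower semi-continuous } f:\Pi(x)\to\mathbb{R}\cup\{\infty\}.\qquad( * )$$ (ii) The integral $\mathbf{F}_n(x)=\frac{1}{|\mathbf{A}_n|}\int_{\mathbf{A}_n}\phi(x)\,|d\phi|$ exists for each $n\in\mathbb{N}$. If $\Pi(x)$ is compact, a subsequence of $(\mathbf{F}_n(x))_n$ converges to a $\mathbb{G}$-invariant element $\bar{x}$ of $\Pi(x)$ that satisfies $( * )$. (iii) The set $X_{\mathbb{G}}:=\{x\in X\,|\,x\text{ is }\mathbb{G}\text{-invariant}\}$ is a closed linear subspace of $X$. Any compact, convex and $\mathbb{G}$-invariant set $K\subset X$ satisfies $$\inf_{z\in K}g(z)\;=\;\inf_{z\in K\cap X_{\mathbb{G}}}g(z)\qquad\text{for every }\mathbb{G}\text{-invariant convex lower semi-continuous } g:K\to\mathbb{R}\cup\{\infty\}.$$ If $g$ is linear, both infima are attained at extreme points (of $K$ and of $K\cap X_{\mathbb{G}}$, respectively).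
   Context: A topological group $\mathbb{G}$ is called nice if its topology is locally compact and Polish; $|\cdot|$ denotes Haar measure (an invariant $\sigma$-finite measure) on $\mathbb{G}$. A Følner sequence in $\mathbb{G}$ is a sequence $\mathbf{A}_1,\mathbf{A}_2,\ldots$ of compact subsets of $\mathbb{G}$ such that $|\mathbf{A}_n\cap K\mathbf{A}_n|/|\mathbf{A}_n|\to 1$ as $n\to\infty$ for all compact $K\subset\mathbb{G}$, where $K\mathbf{A}_n=\{\phi\psi\,|\,\phi\in K,\psi\in\mathbf{A}_n\}$. (A nice group contains a Følner sequence if and only if it is amenable.) An action of $\mathbb{G}$ on $X$, written $(\phi,x)\mapsto\phi(x)=\phi x$, is continuous if it is jointly continuous as a map $\mathbb{G}\times X\to X$, and linear if each map $x\mapsto\phi x$ is linear. An element $x$ is $\mathbb{G}$-invariant if $\phi x=x$ for all $\phi\in\mathbb{G}$; a set $K$ is $\mathbb{G}$-invariant if $\phi K=K$ for all $\phi$; a function $g$ is $\mathbb{G}$-invariant if $g(\phi x)=g(x)$ for all $\phi$ and $x$. The orbit of $x$ is $\mathbb{G}(x)=\{\phi x\,|\,\phi\in\mathbb{G}\}$, and the orbitope $\Pi(x)$ is the closed convex hull of $\mathbb{G}(x)$ in $X$. For a measurable function $h:S\to X$ on a measure space $(S,\mu)$, the integral $\int h\,d\mu$ is the unique element $v\in X$ with $\ell(v)=\int_S(\ell\circ h)\,d\mu$ for every continuous linear $\ell:X\to\mathbb{R}$, if such an element exists. The integral $\int_{\mathbf{A}_n}\phi(x)|d\phi|$ is in this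 sense, with respect to Haar measure.
   Formalization: In (ii), the integral over A_n is shown to exist when the closed convex hull of {φx : φ in A_n} is compact; for compact Π(x), convergence is along a subnet, and along a subsequence if Π(x) is also metrizable. In (iii), attainment assumes K nonempty. The unrestricted claims in (ii) are false. *)

theory Defs
  imports "HOL-Analysis.Analysis"
begin

text \<open>
  Locally convex Hausdorff topological vector spaces over the reals. The constant \<^const>\<open>convex\<close>
  cannot occur in a class specification, so convexity of \<open>V\<close> is spelled out.
\<close>

class locally_convex_t2_space = real_vector + topological_ab_group_add + t2_space +
  assumes tendsto_scaleR_Pair:
    "LIM p (nhds c \<times>\<^sub>F nhds x). fst p *\<^sub>R snd p :> nhds (c *\<^sub>R x)"
  and locally_convex_0:
    "open U \<Longrightarrow> 0 \<in> U \<Longrightarrow>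
      \<exists>V. open V \<and> 0 \<in> V \<and> V \<subseteq> U \<and>
        (\<forall>y\<in>V. \<forall>z\<in>V. \<forall>u\<ge>0. \<forall>v\<ge>0. u + v = 1 \<longrightarrow> u *\<^sub>R y + v *\<^sub>R z \<in> V)"

lemma locally_convex_0':
  fixes U :: "'x::locally_convex_t2_space set"
  assumes "open U" "0 \<in> U"
  shows "\<exists>V. open V \<and> convex V \<and> 0 \<in> V \<and> V \<subseteq> U"
  using locally_convex_0[OF assms] unfolding convex_def by metis

text \<open>
  Groups are types of class \<^class>\<open>topological_group_add\<close>. This class is not commutative: the
  group is arbitrary and only written additively, so \<open>\<phi> + \<psi>\<close> is the product
  of \<open>\<phi>\<close> and \<open>\<psi>\<close> in this order and \<open>0\<close> is the identity.
\<close>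

definition haar_measure :: "'g::topological_group_add measure \<Rightarrow> bool" where
  "haar_measure \<mu> \<longleftrightarrow>
     sets \<mu> = sets borel \<and> sigma_finite_measure \<mu> \<and> emeasure \<mu> UNIV \<noteq> 0 \<and>
     (\<forall>K. compact K \<longrightarrow> emeasure \<mu> K < \<infinity>) \<and>
     (\<forall>\<phi>. \<forall>B\<in>sets \<mu>. emeasure \<mu> ((\<lambda>\<psi>. \<phi> + \<psi>) ` B) = emeasure \<mu> B)"

text \<open>
  The compact set \<open>K\<close> has to be nonempty, as the quotient is constantly 0 for empty \<open>K\<close>.
  Positivity of the denominators is what makes the quotients meaningful.
\<close>

definition folner_sequence :: "'g::topological_group_add measure \<Rightarrow> (nat \<Rightarrow> 'g set) \<Rightarrow> bool" where
  "folner_sequence \<mu> A \<longleftrightarrow>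
     (\<forall>n. compact (A n) \<and> measure \<mu> (A n) > 0) \<and>
     (\<forall>K. compact K \<and> K \<noteq> {} \<longrightarrow>
        (\<lambda>n. measure \<mu> (A n \<inter> {\<phi> + \<psi> | \<phi> \<psi>. \<phi> \<in> K \<and> \<psi> \<in> A n}) / measure \<mu> (A n))
          \<longlonglongrightarrow> 1)"

definition continuous_linear_action ::
    "('g::topological_group_add \<Rightarrow> 'x::locally_convex_t2_space \<Rightarrow> 'x) \<Rightarrow> bool" where
  "continuous_linear_action act \<longleftrightarrow>
     (\<forall>x. act 0 x = x) \<and> (\<forall>\<phi> \<psi> x. act (\<phi> + \<psi>) x = act \<phi> (act \<psi> x)) \<and>
     (\<forall>\<phi>. linear (act \<phi>)) \<and> continuous_on UNIV (\<lambda>(\<phi>, x). act \<phi> x)"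

definition orbit :: "('g \<Rightarrow> 'x \<Rightarrow> 'x) \<Rightarrow> 'x \<Rightarrow> 'x set" where
  "orbit act x = range (\<lambda>\<phi>. act \<phi> x)"

definition orbitope :: "('g \<Rightarrow> 'x \<Rightarrow> 'x) \<Rightarrow> 'x::locally_convex_t2_space \<Rightarrow> 'x set" where
  "orbitope act x = closure (convex hull (orbit act x))"

definition fixed_points :: "('g \<Rightarrow> 'x \<Rightarrow> 'x) \<Rightarrow> 'x set" where
  "fixed_points act = {x. \<forall>\<phi>. act \<phi> x = x}"

definition invariant_set :: "('g \<Rightarrow> 'x \<Rightarrow> 'x) \<Rightarrow> 'x set \<Rightarrow> bool" where
  "invariant_set act K \<longleftrightarrow> (\<forall>\<phi>. act \<phi> ` K = K)"

definition invariant_fun_on :: "('g \<Rightarrow> 'x \<Rightarrow> 'x) \<Rightarrow> 'x set \<Rightarrow> ('x \<Rightarrow> 'b) \<Rightarrow> bool" where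
  "invariant_fun_on act K g \<longleftrightarrow> (\<forall>\<phi>. \<forall>z\<in>K. g (act \<phi> z) = g z)"

text \<open>
  Convex lower semi-continuous functions \<open>S \<rightarrow> \<real> \<union> {\<infinity>}\<close>; values outside \<open>S\<close> are irrelevant.
\<close>

definition convex_lsc_on :: "'x::{real_vector, topological_space} set \<Rightarrow> ('x \<Rightarrow> ereal) \<Rightarrow> bool" where
  "convex_lsc_on S f \<longleftrightarrow>
     (\<forall>z\<in>S. f z \<noteq> -\<infinity>) \<and>
     (\<forall>y\<in>S. \<forall>z\<in>S. \<forall>u\<ge>0. \<forall>v\<ge>0. u + v = 1 \<longrightarrow>
        f (u *\<^sub>R y + v *\<^sub>R z) \<le> ereal u * f y + ereal v * f z) \<and>
     (\<forall>z\<in>S. f z \<le> Liminf (at z within S) f)"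

definition dominated_by_orbit ::
    "('g \<Rightarrow> 'x \<Rightarrow> 'x) \<Rightarrow> 'x::locally_convex_t2_space \<Rightarrow> 'x \<Rightarrow> bool" where
  "dominated_by_orbit act x xbar \<longleftrightarrow>
     (\<forall>f. convex_lsc_on (orbitope act x) f \<longrightarrow> f xbar \<le> (SUP \<phi>. f (act \<phi> x)))"

definition has_weak_integral ::
    "'s measure \<Rightarrow> ('s \<Rightarrow> 'x::locally_convex_t2_space) \<Rightarrow> 'x \<Rightarrow> bool" where
  "has_weak_integral M h v \<longleftrightarrow>
     h \<in> borel_measurable M \<and>
     (\<forall>l::'x \<Rightarrow> real. linear l \<and> continuous_on UNIV l \<longrightarrow>
        integrable M (\<lambda>s. l (h s)) \<and> l v = (\<integral>s. l (h s) \<partial>M))"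

definition weak_integral :: "'s measure \<Rightarrow> ('s \<Rightarrow> 'x::locally_convex_t2_space) \<Rightarrow> 'x" where
  "weak_integral M h = (THE v. has_weak_integral M h v)"

definition folner_average ::
    "'g measure \<Rightarrow> (nat \<Rightarrow> 'g set) \<Rightarrow> ('g \<Rightarrow> 'x \<Rightarrow> 'x) \<Rightarrow> 'x::locally_convex_t2_space \<Rightarrow> nat \<Rightarrow> 'x" where
  "folner_average \<mu> A act x n =
     (1 / measure \<mu> (A n)) *\<^sub>R weak_integral (restrict_space \<mu> (A n)) (\<lambda>\<phi>. act \<phi> x)"

end

theory Submission
  imports Defs
begin

text \<open>
  The domination property is automatic: for a convex lower semi-continuous function, the
  points of the orbitope at which it does not exceed its supremum over the orbit form a closed
  convex set that contains the orbit, hence all of the orbitope (\<open>orbitope_dominated_by_orbit\<close>).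
  What has to be found is a fixed point in the orbitope, and any cluster point of the
  F\<oslash>lner averages is one: if \<open>l\<close> is a continuous linear functional, its values at an
  average and at the translate of this average by \<open>\<phi>\<close> are integrals over \<open>A n\<close> and over
  \<open>\<phi> + A n\<close>, and these sets overlap up to a vanishing proportion
  (\<open>haar_translated_integral_difference\<close>, \<open>folner_average_limit_fixed\<close>). Cluster points exist because
  the averages lie in the compact orbitope; for a metrizable orbitope they are limits of
  subsequences.

  Three facts of functional analysis carry this argument. Continuous functionals separate points
  (\<open>continuous_functionals_separate_points\<close>), which makes weak integrals unique and detects fixed
  points; this is the Hahn--Banach theorem, derived here from the linearity of minimal sublinear
  functionals. Weak integrals of continuous functions on a compact set exist if the closed convex
  hull of the range is compact (\<open>weak_integral_exists\<close>), because sums over finer and finer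
  partitions cluster in that hull. Nonempty compact convex sets have extreme points
  (\<open>extreme_point_exists\<close>).

  For a compact convex invariant set \<open>K\<close>, applying the existence of fixed points to the orbitope
  of each \<open>z \<in> K\<close> shows that no value of an invariant \<open>g\<close> on \<open>K\<close> is below all its values at
  fixed points (\<open>invariant_inf_eq_inf_fixed_points\<close>). If \<open>g\<close> is linear, its minimizers form a
  nonempty compact face, and any extreme point of this face is an extreme point of the whole set.
\<close>

section \<open>Locally convex spaces\<close>

lemma tendsto_scaleR_locally_convex:
  fixes g :: "'a \<Rightarrow> 'x::locally_convex_t2_space"
  assumes "(f \<longlongrightarrow> c) F" "(g \<longlongrightarrow> x) F"
  shows "((\<lambda>s. f s *\<^sub>R g s) \<longlongrightarrow> c *\<^sub>R x) F"
  using filterlim_compose[OF tendsto_scaleR_Pair filterlim_Pair[OF assms]] by simp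

text \<open>
Joint continuity of \<open>(a, b) \<mapsto> u *\<^sub>R a + v *\<^sub>R b\<close> is used one variable at a time: the closure of
\<open>S\<close> absorbs convex combinations of a point of \<open>S\<close> with a point of the closure, and then of two
points of the closure.
\<close>

lemma convex_closure_locally_convex:
  fixes S :: "'x::locally_convex_t2_space set"
  assumes "convex S"
  shows "convex (closure S)"
proof (rule convexI)
  fix y z :: 'x and u v :: real
  assume y: "y \<in> closure S" and z: "z \<in> closure S" and uv: "0 \<le> u" "0 \<le> v" "u + v = 1"
  have step: "u *\<^sub>R a + v *\<^sub>R b \<in> closure S"
    if "0 \<le> u" "0 \<le> v" "u + v = 1" "a \<in> closure S" "\<And>a. a \<in> S \<Longrightarrow> u *\<^sub>R a + v *\<^sub>R b \<in> closure S"
    for a b :: 'x and u v :: real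
  proof -
    have "continuous_on (closure S) (\<lambda>a. u *\<^sub>R a + v *\<^sub>R b)"
      unfolding continuous_on_def
      by (intro ballI tendsto_add tendsto_scaleR_locally_convex tendsto_const tendsto_ident_at)
    then show ?thesis
      using image_closure_subset[of S "\<lambda>a. u *\<^sub>R a + v *\<^sub>R b" "closure S"] that by blast
  qed
  have 1: "u *\<^sub>R a + v *\<^sub>R z \<in> closure S" if "a \<in> S" for a
    using step[of v u z a] uv z that assms closure_subset[of S]
    unfolding convex_def by (metis add.commute subsetD)
  show "u *\<^sub>R y + v *\<^sub>R z \<in> closure S"
    using step[OF uv y] 1 by blast
qed

lemma closed_convex_hull_subset:
  fixes K :: "'x::locally_convex_t2_space set"
  assumes "S \<subseteq> K" "closed K" "convex K"
  shows "closure (convex hull S) \<subseteq> K"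
  by (metis assms closure_minimal hull_minimal)

section \<open>Hahn--Banach\<close>

definition sublinear :: "('x::real_vector \<Rightarrow> real) \<Rightarrow> bool" where
  "sublinear p \<longleftrightarrow> (\<forall>x y. p (x + y) \<le> p x + p y) \<and> (\<forall>t\<ge>0. \<forall>x. p (t *\<^sub>R x) = t * p x)"

lemma sublinearD:
  assumes "sublinear p"
  shows "p (x + y) \<le> p x + p y" "0 \<le> t \<Longrightarrow> p (t *\<^sub>R x) = t * p x" "p 0 = 0" "- p (- x) \<le> p x"
proof -
  show *: "p (x + y) \<le> p x + p y" "0 \<le> t \<Longrightarrow> p (t *\<^sub>R x) = t * p x" for x y t
    using assms unfolding sublinear_def by auto
  show z: "p 0 = 0"
    using *(2)[of 0 0] by simp
  show "- p (- x) \<le> p x"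
    using *(1)[of x "-x"] z by simp
qed

text \<open>
The sublinear functional that \<open>p\<close> becomes when it is forced to be additive in direction \<open>a\<close>:
it is at most \<open>p\<close>, and its value at \<open>- a\<close> is at most \<open>- p a\<close>. Every linear functional below
\<open>linearize_along a p\<close> therefore agrees with \<open>p\<close> at \<open>a\<close>.
\<close>

definition linearize_along :: "'x::real_vector \<Rightarrow> ('x \<Rightarrow> real) \<Rightarrow> 'x \<Rightarrow> real" where
  "linearize_along a p y = (INF t\<in>{0..}. p (y + t *\<^sub>R a) - t * p a)"

lemma linearize_along_le:
  assumes "sublinear p" "0 \<le> t"
  shows "linearize_along a p y \<le> p (y + t *\<^sub>R a) - t * p a"
    and "- p (- y) \<le> linearize_along a p y"
proof -
  have *: "- p (- y) \<le> p (y + s *\<^sub>R a) - s * p a" if "0 \<le> s" for s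
    using sublinearD(1)[OF assms(1), of "y + s *\<^sub>R a" "- y"]
      sublinearD(2)[OF assms(1), of s a] that by simp
  then have "bdd_below ((\<lambda>t. p (y + t *\<^sub>R a) - t * p a) ` {0..})"
    by (intro bdd_belowI2) auto
  then show "linearize_along a p y \<le> p (y + t *\<^sub>R a) - t * p a"
    unfolding linearize_along_def using assms by (intro cINF_lower) auto
  show "- p (- y) \<le> linearize_along a p y"
    unfolding linearize_along_def using * by (intro cINF_greatest) auto
qed

lemma sublinear_linearize_along:
  assumes p: "sublinear p"
  shows "sublinear (linearize_along a p)"
proof -
  let ?q = "linearize_along a p"
  note le = linearize_along_le(1)[OF p]
  have add: "?q (x + y) \<le> ?q x + ?q y" for x y
  proof -
    have *: "?q (x + y) \<le> (p (x + s *\<^sub>R a) - s * p a) + (p (y + t *\<^sub>R a) - t * p a)"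
      if "0 \<le> s" "0 \<le> t" for s t
      using le[of "s + t" a "x + y"] that sublinearD(1)[OF p, of "x + s *\<^sub>R a" "y + t *\<^sub>R a"]
      by (simp add: algebra_simps)
    have "?q (x + y) - (p (x + s *\<^sub>R a) - s * p a) \<le> ?q y" if "0 \<le> s" for s
      unfolding linearize_along_def[of a p y] using * that by (intro cINF_greatest) force+
    then have "?q (x + y) - ?q y \<le> p (x + s *\<^sub>R a) - s * p a" if "0 \<le> s" for s
      using that by force
    then have "?q (x + y) - ?q y \<le> ?q x"
      unfolding linearize_along_def[of a p x] by (intro cINF_greatest) auto
    then show ?thesis by simp
  qed
  have scale_le: "c * ?q x \<le> ?q (c *\<^sub>R x)" if "0 < c" for c x
  proof -
    have "c * ?q x \<le> p (c *\<^sub>R x + t *\<^sub>R a) - t * p a" if "0 \<le> t" for t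
    proof -
      have "c * ?q x \<le> c * (p (x + (t / c) *\<^sub>R a) - (t / c) * p a)"
        using le[of "t / c" a x] that \<open>0 < c\<close> by (intro mult_left_mono) auto
      also have "\<dots> = p (c *\<^sub>R (x + (t / c) *\<^sub>R a)) - t * p a"
        using sublinearD(2)[OF p, of c "x + (t / c) *\<^sub>R a"] \<open>0 < c\<close>
        by (simp add: right_diff_distrib)
      finally show ?thesis
        using \<open>0 < c\<close> by (simp add: scaleR_add_right)
    qed
    then show ?thesis
      unfolding linearize_along_def[of a p "c *\<^sub>R x"] by (intro cINF_greatest) auto
  qed
  \<comment> \<open>The inequality just shown, applied to \<open>1 / c\<close>, is the converse inequality for \<open>c\<close>.\<close>
  have "?q (c *\<^sub>R x) = c * ?q x" if "0 \<le> c" for c x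
  proof (cases "c = 0")
    case True
    have "?q 0 \<le> 0" "0 \<le> ?q 0"
      using linearize_along_le[OF p order_refl, where a = a and y = 0] sublinearD(3)[OF p] by auto
    with True show ?thesis by simp
  next
    case False
    with that have c: "0 < c" by simp
    have "(1 / c) * ?q (c *\<^sub>R x) \<le> ?q x"
      using scale_le[of "1 / c" "c *\<^sub>R x"] c by simp
    then show ?thesis
      using scale_le[OF c, of x] c by (simp add: field_simps)
  qed
  with add show ?thesis
    unfolding sublinear_def by blast
qed

text \<open>
Zorn's lemma, applied to sublinear functionals instead of partially defined linear ones. The
pointwise infimum of a chain is finite because \<open>- p (- x)\<close> bounds all its members from below, and
subadditive because two members of the chain can be replaced by the smaller one.
\<close>

lemma minimal_sublinear_exists:
  assumes p: "sublinear p"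
  obtains q where "sublinear q" "q \<le> p" "\<And>r. sublinear r \<Longrightarrow> r \<le> q \<Longrightarrow> r = q"
proof -
  let ?A = "{q. sublinear q \<and> q \<le> p}"
  have "\<exists>m\<in>?A. \<forall>a\<in>?A. a \<le> m \<longrightarrow> a = m"
  proof (rule predicate_Zorn)
    show "partial_order_on ?A (relation_of (\<lambda>m a. a \<le> m) ?A)"
      by (rule partial_order_on_relation_ofI) auto
  next
    fix C
    assume C: "C \<in> Chains (relation_of (\<lambda>m a. a \<le> m) ?A)"
    then have CA: "C \<subseteq> ?A" and chain: "\<And>f g. f \<in> C \<Longrightarrow> g \<in> C \<Longrightarrow> f \<le> g \<or> g \<le> f"
      unfolding Chains_def relation_of_def by auto
    show "\<exists>u\<in>?A. \<forall>a\<in>C. u \<le> a"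
    proof (cases "C = {}")
      case True
      with p show ?thesis by auto
    next
      case False
      define u where "u x = (INF f\<in>C. f x)" for x
      have low: "- p (- x) \<le> f x" if "f \<in> C" for f x
        using that CA sublinearD(4)[of f x] le_funD[of f p "- x"] by force
      have le: "u x \<le> f x" if "f \<in> C" for f x
        unfolding u_def using that low by (intro cINF_lower bdd_belowI2) auto
      have gr: "c \<le> u x" if "\<And>f. f \<in> C \<Longrightarrow> c \<le> f x" for c x
        unfolding u_def using that False by (intro cINF_greatest) auto
      have add: "u (x + y) \<le> u x + u y" for x y
      proof -
        have fg: "u (x + y) \<le> f x + g y" if f: "f \<in> C" and g: "g \<in> C" for f g
        proof -
          obtain h where "h \<in> C" "h \<le> f" "h \<le> g"
            using chain[OF f g] f g by blast
          then have "u (x + y) \<le> h x + h y"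
            using le[of h "x + y"] sublinearD(1)[of h x y] CA by force
          also have "\<dots> \<le> f x + g y"
            using \<open>h \<le> f\<close> \<open>h \<le> g\<close> by (intro add_mono) (auto dest: le_funD)
          finally show ?thesis .
        qed
        have "u (x + y) - f x \<le> u y" if "f \<in> C" for f
          by (rule gr) (use fg[OF that] in force)
        then have "u (x + y) - u y \<le> u x"
          by (intro gr) force
        then show ?thesis by simp
      qed
      have scale_le: "c * u x \<le> u (c *\<^sub>R x)" if "0 \<le> c" for c x
        by (rule gr) (use CA le that in \<open>force simp: sublinearD(2) intro: mult_left_mono\<close>)
      have "u (c *\<^sub>R x) = c * u x" if "0 \<le> c" for c x
      proof (cases "c = 0")
        case True
        obtain f where "f \<in> C" using False by blast
        then have "u 0 \<le> 0" using le[of f 0] CA sublinearD(3)[of f] by auto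
        moreover have "0 \<le> u 0"
          by (rule gr) (use CA sublinearD(3) in force)
        ultimately show ?thesis using True by simp
      next
        case False
        with that have c: "0 < c" by simp
        have "(1 / c) * u (c *\<^sub>R x) \<le> u x"
          using scale_le[of "1 / c" "c *\<^sub>R x"] c by simp
        then show ?thesis
          using scale_le[OF that, of x] c by (simp add: field_simps)
      qed
      with add have "sublinear u"
        unfolding sublinear_def by blast
      moreover have "u \<le> p"
        using False CA le by (metis (no_types, lifting) equals0I le_fun_def mem_Collect_eq order_trans subsetD)
      ultimately show ?thesis
        using le by (auto simp: le_fun_def)
    qed
  qed
  then obtain q where "sublinear q" "q \<le> p" "\<And>r. sublinear r \<Longrightarrow> r \<le> p \<Longrightarrow> r \<le> q \<Longrightarrow> r = q"
    by blast
  then show thesis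
    using that order_trans by metis
qed

text \<open>
Since linearizing \<open>q\<close> along \<open>a\<close> cannot make it smaller, \<open>q y \<le> q (y + a) - q a\<close>, which together with
subadditivity makes \<open>q\<close> additive.
\<close>

lemma minimal_sublinear_linear:
  assumes q: "sublinear q" and min: "\<And>r. sublinear r \<Longrightarrow> r \<le> q \<Longrightarrow> r = q"
  shows "linear q"
proof -
  have "linearize_along a q = q" for a
    using linearize_along_le(1)[OF q, of 0 a]
    by (intro min sublinear_linearize_along q) (simp add: le_fun_def)
  then have "q y \<le> q (y + a) - q a" for y a
    using linearize_along_le(1)[OF q, of 1 a y] by simp
  then have add: "q (y + a) = q y + q a" for y a
    using sublinearD(1)[OF q, of y a] by (smt (verit))
  have minus: "q (- y) = - q y" for y
    using add[of y "- y"] sublinearD(3)[OF q] by simp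
  have "q (c *\<^sub>R y) = c * q y" for c y
  proof (cases "0 \<le> c")
    case False
    then show ?thesis
      using sublinearD(2)[OF q, of "- c" y] minus[of "c *\<^sub>R y"] by simp
  qed (simp add: sublinearD(2)[OF q])
  with add show ?thesis
    by (intro linearI) auto
qed

theorem Hahn_Banach_sublinear:
  assumes p: "sublinear p"
  obtains l where "linear l" "\<And>y. l y \<le> p y" "l a = p a"
proof -
  let ?p = "linearize_along a p"
  obtain l where l: "sublinear l" "l \<le> ?p" "\<And>r. sublinear r \<Longrightarrow> r \<le> l \<Longrightarrow> r = l"
    using minimal_sublinear_exists[OF sublinear_linearize_along[OF p]] by metis
  have lin: "linear l"
    using minimal_sublinear_linear[OF l(1) l(3)] .
  have le: "l y \<le> p y" for y
    using le_funD[OF l(2), of y] linearize_along_le(1)[OF p, of 0 a y] by simp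
  have "l (- a) \<le> - p a"
    using le_funD[OF l(2), of "- a"] linearize_along_le(1)[OF p, of 1 a "- a"]
      sublinearD(3)[OF p] by simp
  then have "p a \<le> l a"
    using linear_neg[OF lin, of a] by simp
  with le[of a] have "l a = p a" by simp
  with lin le show thesis using that by blast
qed

text \<open>
The Minkowski functional of \<open>V\<close>.
\<close>

definition gauge_of :: "'x::real_vector set \<Rightarrow> 'x \<Rightarrow> real" where
  "gauge_of V y = Inf {t. 0 < t \<and> (1 / t) *\<^sub>R y \<in> V}"

lemma sublinear_gauge_of:
  fixes V :: "'x::locally_convex_t2_space set"
  assumes V: "open V" "convex V" "0 \<in> V"
  shows "sublinear (gauge_of V)"
    and "y \<in> V \<Longrightarrow> gauge_of V y \<le> 1"
    and "y \<notin> V \<Longrightarrow> 1 \<le> gauge_of V y"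
proof -
  let ?S = "\<lambda>y. {t. 0 < t \<and> (1 / t) *\<^sub>R y \<in> V}"
  have ne: "?S y \<noteq> {}" for y
  proof -
    \<comment> \<open>Open neighbourhoods of 0 are absorbing, so the gauge is an infimum over a nonempty set.\<close>
    have "((\<lambda>n. (1 / real n) *\<^sub>R y) \<longlongrightarrow> 0 *\<^sub>R y) sequentially"
      by (intro tendsto_scaleR_locally_convex tendsto_const lim_1_over_n)
    then have "\<forall>\<^sub>F n in sequentially. (1 / real n) *\<^sub>R y \<in> V"
      using V by (auto dest: topological_tendstoD)
    then obtain N where "\<And>n. n \<ge> N \<Longrightarrow> (1 / real n) *\<^sub>R y \<in> V"
      unfolding eventually_sequentially by blast
    then have "real (Suc N) \<in> ?S y"
      using le_SucI[OF order_refl, of N] of_nat_0_less_iff[of "Suc N"] by blast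
    then show ?thesis by blast
  qed
  have le: "gauge_of V y \<le> t" if "t \<in> ?S y" for t y
    unfolding gauge_of_def using that by (intro cInf_lower bdd_belowI[of _ 0]) auto
  have gr: "c \<le> gauge_of V y" if "\<And>t. t \<in> ?S y \<Longrightarrow> c \<le> t" for c y
    unfolding gauge_of_def using that ne[of y] by (intro cInf_greatest) auto
  have add: "gauge_of V (x + y) \<le> gauge_of V x + gauge_of V y" for x y
  proof -
    have *: "gauge_of V (x + y) \<le> s + t" if s: "s \<in> ?S x" and t: "t \<in> ?S y" for s t
    proof (rule le)
      have "(s / (s + t)) *\<^sub>R ((1 / s) *\<^sub>R x) + (t / (s + t)) *\<^sub>R ((1 / t) *\<^sub>R y) \<in> V"
        by (rule convexD[OF V(2)])
          (use s t in \<open>auto simp flip: add_divide_distrib\<close>)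
      then show "s + t \<in> ?S (x + y)"
        using s t by (auto simp: scaleR_add_right)
    qed
    have "gauge_of V (x + y) - s \<le> gauge_of V y" if "s \<in> ?S x" for s
      by (rule gr) (use *[OF that] in force)
    then have "gauge_of V (x + y) - gauge_of V y \<le> gauge_of V x"
      by (intro gr) force
    then show ?thesis by simp
  qed
  have scale_le: "c * gauge_of V y \<le> gauge_of V (c *\<^sub>R y)" if c: "0 < c" for c y
  proof (rule gr)
    fix t assume t: "t \<in> ?S (c *\<^sub>R y)"
    then have "gauge_of V y \<le> t / c"
      by (intro le) (use c in auto)
    then show "c * gauge_of V y \<le> t"
      using c by (simp add: field_simps)
  qed
  have "gauge_of V (c *\<^sub>R y) = c * gauge_of V y" if "0 \<le> c" for c y
  proof (cases "c = 0")
    case True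
    have "0 \<le> gauge_of V 0"
      by (rule gr) auto
    moreover have "gauge_of V 0 \<le> 0 + e" if "0 < e" for e
      using le[of e 0] V(3) that by simp
    ultimately show ?thesis
      using True by (metis field_le_epsilon mult_zero_left order_antisym scaleR_zero_left)
  next
    case False
    with that have c: "0 < c" by simp
    have "(1 / c) * gauge_of V (c *\<^sub>R y) \<le> gauge_of V y"
      using scale_le[of "1 / c" "c *\<^sub>R y"] c by simp
    then show ?thesis
      using scale_le[OF c, of y] c by (simp add: field_simps)
  qed
  with add show "sublinear (gauge_of V)"
    unfolding sublinear_def by blast
  show "gauge_of V y \<le> 1" if "y \<in> V"
    by (rule le) (use that in auto)
  show "1 \<le> gauge_of V y" if "y \<notin> V"
  proof (rule gr)
    fix t assume t: "t \<in> ?S y"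
    show "1 \<le> t"
    proof (rule ccontr)
      assume "\<not> 1 \<le> t"
      then have "t *\<^sub>R ((1 / t) *\<^sub>R y) + (1 - t) *\<^sub>R 0 \<in> V"
        using t V(3) by (intro convexD[OF V(2)]) auto
      then show False
        using t that by simp
    qed
  qed
qed

lemma continuous_on_linear_bounded_near_0:
  fixes l :: "'x::locally_convex_t2_space \<Rightarrow> real"
  assumes l: "linear l" and W: "open W" "0 \<in> W" and bound: "\<And>y. y \<in> W \<Longrightarrow> \<bar>l y\<bar> \<le> 1"
  shows "continuous_on UNIV l"
  unfolding continuous_on_def
proof (intro ballI tendstoI)
  fix x :: 'x and e :: real
  assume e: "0 < e"
  have "((\<lambda>y. (2 / e) *\<^sub>R (y - x)) \<longlongrightarrow> (2 / e) *\<^sub>R (x - x)) (at x)"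
    by (intro tendsto_scaleR_locally_convex tendsto_diff tendsto_const tendsto_ident_at)
  then have "\<forall>\<^sub>F y in at x. (2 / e) *\<^sub>R (y - x) \<in> W"
    using W by (auto dest: topological_tendstoD)
  then show "\<forall>\<^sub>F y in at x. dist (l y) (l x) < e"
  proof eventually_elim
    case (elim y)
    have "(2 / e) * \<bar>l y - l x\<bar> \<le> 1"
      using bound[OF elim] e
      unfolding linear_scale[OF l] linear_diff[OF l] by (simp only: real_scaleR_def abs_mult) simp
    then show ?case
      using e by (simp add: dist_real_def field_simps)
  qed
qed

text \<open>
The gauge of a convex neighbourhood \<open>V\<close> of 0 that misses \<open>z = y - x\<close> is at least 1 at \<open>z\<close> and at
most 1 on \<open>V\<close>. A linear functional below the gauge that agrees with it at \<open>z\<close> is hence positive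
at \<open>z\<close> and bounded on the neighbourhood \<open>V \<inter> - V\<close>, which makes it continuous.
\<close>

theorem continuous_functionals_separate_points:
  fixes x y :: "'x::locally_convex_t2_space"
  assumes "x \<noteq> y"
  obtains l :: "'x \<Rightarrow> real" where "linear l" "continuous_on UNIV l" "l x < l y"
proof -
  define z where "z = y - x"
  have "z \<noteq> 0" using assms by (simp add: z_def)
  then obtain U where "open U" "0 \<in> U" "z \<notin> U"
    using t1_space by metis
  then obtain V where V: "open V" "convex V" "0 \<in> V" "V \<subseteq> U"
    using locally_convex_0' by metis
  note g = sublinear_gauge_of[OF V(1-3)]
  obtain l where l: "linear l" "\<And>y. l y \<le> gauge_of V y" "l z = gauge_of V z"
    using Hahn_Banach_sublinear[OF g(1)] by metis
  have "open (V \<inter> uminus -` V)"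
    using V(1) by (intro open_Int open_vimage) (auto intro!: continuous_intros)
  moreover have "\<bar>l y\<bar> \<le> 1" if "y \<in> V \<inter> uminus -` V" for y
    using l(2)[of y] l(2)[of "- y"] g(2)[of y] g(2)[of "- y"] linear_neg[OF l(1), of y] that
    by auto
  ultimately have "continuous_on UNIV l"
    using l(1) V(3) by (intro continuous_on_linear_bounded_near_0[of l "V \<inter> uminus -` V"]) auto
  moreover have "l x < l y"
    using l(3) g(3)[of z] V(4) \<open>z \<notin> U\<close> linear_diff[OF l(1), of y x]
    unfolding z_def by force
  ultimately show thesis using l(1) that by blast
qed

section \<open>Lower semicontinuous convex functions on compact sets\<close>

lemma convex_lsc_on_subset:
  assumes "convex_lsc_on K f" "S \<subseteq> K"
  shows "convex_lsc_on S f"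
proof -
  have "f z \<le> Liminf (at z within S) f" if "z \<in> S" for z
  proof -
    have "f z \<le> Liminf (at z within K) f"
      using assms that unfolding convex_lsc_on_def by blast
    also have "\<dots> \<le> Liminf (at z within S) f"
      unfolding Liminf_def
      by (rule SUP_subset_mono) (auto intro: filter_leD[OF at_le[OF assms(2)]])
    finally show ?thesis .
  qed
  then show ?thesis
    using assms unfolding convex_lsc_on_def by (meson subsetD)
qed

text \<open>
Closedness and convexity of the sublevel sets are the two ways in which a convex lower
semi-continuous function enters the arguments below.
\<close>

lemma closed_sublevel_convex_lsc_on:
  fixes K :: "'x::{real_vector, t2_space} set"
  assumes f: "convex_lsc_on K f" and K: "closed K"
  shows "closed {z \<in> K. f z \<le> c}"
  unfolding closed_limpt
proof (intro allI impI)
  fix z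
  let ?S = "{z \<in> K. f z \<le> c}"
  assume lim: "z islimpt ?S"
  then have zK: "z \<in> K"
    using K closed_limpt islimpt_subset[OF lim, of K] by auto
  have "f z \<le> c"
  proof (rule ccontr)
    assume "\<not> f z \<le> c"
    then have "c < f z" by simp
    also have "f z \<le> Liminf (at z within K) f"
      using f zK unfolding convex_lsc_on_def by blast
    finally have "c < Liminf (at z within K) f" .
    then have "\<forall>\<^sub>F y in at z within K. c < f y"
      by (rule less_LiminfD)
    then have "\<forall>\<^sub>F y in at z within ?S. c < f y"
      by (rule filter_leD[OF at_le, rotated]) auto
    moreover have "\<forall>\<^sub>F y in at z within ?S. y \<in> ?S"
      by (simp add: eventually_at_filter)
    ultimately have "\<forall>\<^sub>F y in at z within ?S. False"
      by eventually_elim auto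
    then show False
      using lim by (simp add: trivial_limit_within)
  qed
  with zK show "z \<in> ?S" by simp
qed

lemma convex_sublevel_convex_lsc_on:
  assumes f: "convex_lsc_on K f" and K: "convex K"
  shows "convex {z \<in> K. f z \<le> c}"
proof (rule convexI)
  fix y z and u v :: real
  assume y: "y \<in> {z \<in> K. f z \<le> c}" and z: "z \<in> {z \<in> K. f z \<le> c}"
    and uv: "0 \<le> u" "0 \<le> v" "u + v = 1"
  have "f (u *\<^sub>R y + v *\<^sub>R z) \<le> ereal u * f y + ereal v * f z"
    using f y z uv unfolding convex_lsc_on_def by blast
  also have "\<dots> \<le> ereal u * c + ereal v * c"
    using y z uv by (intro add_mono ereal_mult_left_mono) auto
  also have "\<dots> = c"
    using uv by (metis ereal_left_distrib ereal_less_eq(5) mult.commute one_ereal_def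
        plus_ereal.simps(1) mult_1)
  finally show "u *\<^sub>R y + v *\<^sub>R z \<in> {z \<in> K. f z \<le> c}"
    using convexD[OF K _ _ uv] y z by auto
qed

text \<open>
The sublevel sets for levels above the infimum are closed and nested, so by compactness they have
a common point.
\<close>

lemma convex_lsc_on_attains_inf:
  fixes K :: "'x::{real_vector, t2_space} set"
  assumes f: "convex_lsc_on K f" and K: "compact K" "K \<noteq> {}"
  obtains z where "z \<in> K" "f z = (INF z\<in>K. f z)"
proof -
  let ?m = "INF z\<in>K. f z"
  have "K \<inter> (\<Inter>c\<in>{?m<..}. {z \<in> K. f z \<le> c}) \<noteq> {}"
  proof (rule compact_imp_fip_image[OF K(1)])
    show "closed {z \<in> K. f z \<le> c}" for c
      by (rule closed_sublevel_convex_lsc_on[OF f compact_imp_closed[OF K(1)]])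
    fix I assume I: "finite I" "I \<subseteq> {?m<..}"
    show "K \<inter> (\<Inter>c\<in>I. {z \<in> K. f z \<le> c}) \<noteq> {}"
    proof (cases "I = {}")
      case True
      with K(2) show ?thesis by simp
    next
      case False
      then have "?m < Min I"
        using I by auto
      then obtain z where "z \<in> K" "f z < Min I"
        by (auto simp: INF_less_iff)
      then have "z \<in> K \<inter> (\<Inter>c\<in>I. {z \<in> K. f z \<le> c})"
        using I(1) by (auto intro: order.trans[OF less_imp_le Min_le])
      then show ?thesis by blast
    qed
  qed
  then obtain z where z: "z \<in> K" "\<And>c. ?m < c \<Longrightarrow> f z \<le> c"
    by auto
  have "f z \<le> ?m"
    by (rule dense_ge) (rule z(2))
  moreover have "?m \<le> f z"
    using z(1) by (rule INF_lower)
  ultimately show thesis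
    using that z(1) by (simp add: order_antisym)
qed

section \<open>Extreme points\<close>

lemma linear_argmin_face_of:
  fixes L :: "'x::real_vector \<Rightarrow> real"
  assumes K: "convex K" and L: "linear L" and m: "\<And>z. z \<in> K \<Longrightarrow> m \<le> L z"
  shows "{z \<in> K. L z = m} face_of K"
  unfolding face_of_def
proof (intro conjI ballI impI)
  show "convex {z \<in> K. L z = m}"
    using K by (auto simp: convex_def linear_add[OF L] linear_scale[OF L] simp flip: distrib_right)
next
  fix a b z
  assume ab: "a \<in> K" "b \<in> K" and z: "z \<in> {z \<in> K. L z = m}" "z \<in> open_segment a b"
  then obtain u where u: "0 < u" "u < 1" "z = (1 - u) *\<^sub>R a + u *\<^sub>R b"
    by (auto simp: in_segment)
  \<comment> \<open>An average of two numbers that are at least \<open>m\<close> equals \<open>m\<close> only if both do.\<close>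
  then have "m = (1 - u) * L a + u * L b"
    using z(1) by (simp add: linear_add[OF L] linear_scale[OF L])
  then have eq: "(1 - u) * (L a - m) + u * (L b - m) = 0"
    by (simp add: algebra_simps)
  have "0 \<le> (1 - u) * (L a - m)" "0 \<le> u * (L b - m)"
    using u m[OF ab(1)] m[OF ab(2)] by simp_all
  then have "(1 - u) * (L a - m) = 0" "u * (L b - m) = 0"
    using eq by linarith+
  then show "a \<in> {z \<in> K. L z = m}" "b \<in> {z \<in> K. L z = m}"
    using u ab by auto
qed auto

text \<open>
The first half of the Krein--Milman theorem: by Zorn's lemma there is a minimal nonempty closed
face, where compactness bounds the chains. On a minimal face every continuous functional is
constant, because its minimizers form a closed subface; since functionals separate points, the
face is a singleton.
\<close>

theorem extreme_point_exists:
  fixes K :: "'x::locally_convex_t2_space set"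
  assumes K: "compact K" "convex K" "K \<noteq> {}"
  obtains z where "z extreme_point_of K"
proof -
  let ?A = "{F. F face_of K \<and> closed F \<and> F \<noteq> {}}"
  have "\<exists>F\<in>?A. \<forall>G\<in>?A. G \<subseteq> F \<longrightarrow> G = F"
  proof (rule predicate_Zorn)
    show "partial_order_on ?A (relation_of (\<lambda>F G. G \<subseteq> F) ?A)"
      by (rule partial_order_on_relation_ofI) auto
  next
    fix C
    assume C: "C \<in> Chains (relation_of (\<lambda>F G. G \<subseteq> F) ?A)"
    then have CA: "C \<subseteq> ?A" and chain: "\<And>F G. F \<in> C \<Longrightarrow> G \<in> C \<Longrightarrow> F \<subseteq> G \<or> G \<subseteq> F"
      unfolding Chains_def relation_of_def by auto
    show "\<exists>u\<in>?A. \<forall>F\<in>C. u \<subseteq> F"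
    proof (cases "C = {}")
      case True
      then show ?thesis
        using K by (auto intro: face_of_refl compact_imp_closed)
    next
      case False
      have "K \<inter> \<Inter>C \<noteq> {}"
      proof (rule compact_imp_fip[OF K(1)])
        show "closed F" if "F \<in> C" for F
          using that CA by auto
        fix D assume D: "finite D" "D \<subseteq> C"
        show "K \<inter> \<Inter>D \<noteq> {}"
        proof (cases "D = {}")
          case True
          with K(3) show ?thesis by simp
        next
          case False
          then obtain F where F: "F \<in> D" "\<And>G. G \<in> D \<Longrightarrow> G \<subseteq> F \<Longrightarrow> F = G"
            using finite_has_minimal[OF D(1)] by metis
          then have "F \<subseteq> \<Inter>D"
            using chain D(2) by blast
          moreover have "F \<noteq> {}" "F \<subseteq> K"
            using F(1) D(2) CA by (auto dest: face_of_imp_subset)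
          ultimately show ?thesis by blast
        qed
      qed
      moreover have "\<Inter>C face_of K"
        using False CA by (intro face_of_Inter) auto
      moreover have "closed (\<Inter>C)"
        using CA by (intro closed_Inter) auto
      ultimately show ?thesis by auto
    qed
  qed
  then obtain F where F: "F face_of K" "closed F" "F \<noteq> {}"
    and min: "\<And>G. G face_of K \<Longrightarrow> closed G \<Longrightarrow> G \<noteq> {} \<Longrightarrow> G \<subseteq> F \<Longrightarrow> G = F"
    by blast
  obtain a where a: "a \<in> F" using F(3) by blast
  have "b = a" if b: "b \<in> F" for b
  proof (rule ccontr)
    assume "b \<noteq> a"
    then obtain l :: "'x \<Rightarrow> real" where l: "linear l" "continuous_on UNIV l" "l a < l b"
      using continuous_functionals_separate_points by metis
    have "compact F"
      using compact_Int_closed[OF K(1) F(2)] face_of_imp_subset[OF F(1)] by (simp add: Int_absorb1)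
    then obtain z where z: "z \<in> F" "\<And>y. y \<in> F \<Longrightarrow> l z \<le> l y"
      using continuous_attains_inf[of F l] F(3) continuous_on_subset[OF l(2)] by blast
    let ?G = "{y \<in> F. l y = l z}"
    have "?G face_of F"
      using face_of_imp_convex[OF F(1)] l(1) z(2) by (rule linear_argmin_face_of)
    then have "?G face_of K"
      using F(1) face_of_trans by blast
    moreover have "closed ?G"
      using F(2) l(2) by (auto simp: Collect_conj_eq intro!: closed_Int closed_Collect_eq)
    ultimately have "?G = F"
      using z(1) by (intro min) auto
    then have "l a = l z" "l b = l z"
      using a b by blast+
    with l(3) show False by simp
  qed
  with a have "F = {a}" by blast
  with F(1) show thesis
    using that face_of_singleton by blast
qed

text \<open>
The functional \<open>L\<close> may be discontinuous. Lower semicontinuity on \<open>K\<close> still makes its minimizers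
a nonempty compact face of \<open>K\<close>, and an extreme point of a face is an extreme point of \<open>K\<close>.
\<close>

lemma linear_lsc_inf_attained_at_extreme_point:
  fixes K :: "'x::locally_convex_t2_space set"
  assumes K: "compact K" "convex K" "K \<noteq> {}" and g: "convex_lsc_on K g"
    and L: "linear L" "\<And>z. z \<in> K \<Longrightarrow> g z = ereal (L z)"
  obtains z where "z extreme_point_of K" "g z = (INF z\<in>K. g z)"
proof -
  obtain y where y: "y \<in> K" "g y = (INF z\<in>K. g z)"
    using convex_lsc_on_attains_inf[OF g K(1,3)] .
  have min: "L y \<le> L z" if "z \<in> K" for z
    using INF_lower[OF that, of g] y L(2) that by (metis ereal_less_eq(3))
  let ?F = "{z \<in> K. L z = L y}"
  have face: "?F face_of K"
    by (rule linear_argmin_face_of[OF K(2) L(1) min])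
  have "?F = K \<inter> {z \<in> K. g z \<le> g y}"
    using L(2) y(1) min by (auto intro: order_antisym)
  then have "compact ?F"
    using compact_Int_closed[OF K(1) closed_sublevel_convex_lsc_on[OF g compact_imp_closed[OF K(1)]]]
    by simp
  then obtain z where z: "z extreme_point_of ?F"
    using extreme_point_exists face_of_imp_convex[OF face] y(1) by blast
  then have "{z} face_of ?F"
    by (simp add: face_of_singleton)
  then have "{z} face_of K"
    using face by (rule face_of_trans)
  then have "z extreme_point_of K"
    by (simp add: face_of_singleton)
  moreover have "z \<in> K" "L z = L y"
    using z by (auto simp: extreme_point_of_def)
  then have "g z = (INF z\<in>K. g z)"
    using L(2)[of z] L(2)[of y] y by simp
  ultimately show thesis by (rule that)
qed

section \<open>Orbitopes\<close>

lemma orbitope_props: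
  fixes x :: "'x::locally_convex_t2_space"
  shows orbit_subset_orbitope: "orbit act x \<subseteq> orbitope act x"
    and closed_orbitope: "closed (orbitope act x)"
    and convex_orbitope: "convex (orbitope act x)"
  unfolding orbitope_def
  by (rule order_trans[OF hull_subset closure_subset], rule closed_closure,
      rule convex_closure_locally_convex[OF convex_convex_hull])

text \<open>
The domination property holds at every point of the orbitope: the set where \<open>f\<close> is at most its
supremum over the orbit is closed, convex and contains the orbit. Only invariance has to be
arranged when \<open>xbar\<close> is chosen.
\<close>

lemma orbitope_dominated_by_orbit:
  assumes "y \<in> orbitope act x"
  shows "dominated_by_orbit act x y"
  unfolding dominated_by_orbit_def
proof (intro allI impI)
  fix f
  assume f: "convex_lsc_on (orbitope act x) f"
  let ?S = "{z \<in> orbitope act x. f z \<le> (SUP \<phi>. f (act \<phi> x))}"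
  have "orbit act x \<subseteq> ?S"
    using orbit_subset_orbitope[of act x] by (auto simp: orbit_def intro: SUP_upper)
  then have "orbitope act x \<subseteq> ?S"
    using closed_sublevel_convex_lsc_on[OF f closed_orbitope]
      convex_sublevel_convex_lsc_on[OF f convex_orbitope]
    unfolding orbitope_def[of act x] by (intro closed_convex_hull_subset)
  with assms show "f y \<le> (SUP \<phi>. f (act \<phi> x))" by blast
qed

lemma continuous_linear_actionD:
  assumes "continuous_linear_action act"
  shows "act (\<phi> + \<psi>) x = act \<phi> (act \<psi> x)" "linear (act \<phi>)"
    and "continuous_on UNIV (act \<phi>)" "continuous_on UNIV (\<lambda>\<phi>. act \<phi> x)"
proof -
  note defn = assms[unfolded continuous_linear_action_def]
  show "act (\<phi> + \<psi>) x = act \<phi> (act \<psi> x)"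
    using defn by (elim conjE) (drule spec, drule spec, erule spec)
  show "linear (act \<phi>)" using defn by (elim conjE) (erule spec)
  have c: "continuous_on UNIV (\<lambda>(\<phi>, x). act \<phi> x)" using defn by (elim conjE)
  show "continuous_on UNIV (act \<phi>)"
    using continuous_on_compose2[OF c
        continuous_on_Pair[OF continuous_on_const[of UNIV \<phi>] continuous_on_id]] by simp
  show "continuous_on UNIV (\<lambda>\<phi>. act \<phi> x)"
    using continuous_on_compose2[OF c
        continuous_on_Pair[OF continuous_on_id continuous_on_const[of UNIV x]]] by simp
qed

lemma subspace_closed_fixed_points:
  assumes "continuous_linear_action act"
  shows "subspace (fixed_points act)" "closed (fixed_points act)"
proof -
  note act = continuous_linear_actionD[OF assms]
  show "subspace (fixed_points act)"
    unfolding subspace_def fixed_points_def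
    by (simp add: linear_0[OF act(2)] linear_add[OF act(2)] linear_scale[OF act(2)])
  show "closed (fixed_points act)"
    unfolding fixed_points_def
    by (intro closed_Collect_all closed_Collect_eq act(3) continuous_on_id)
qed

section \<open>Cluster points along filters\<close>

text \<open>
In a compact space that is not metrizable a sequence may have no convergent subsequence. The
filter \<open>F\<close> takes the role of a convergent subnet.
\<close>

lemma compact_sequence_cluster_filter:
  fixes f :: "nat \<Rightarrow> 'x::topological_space"
  assumes "compact U" "\<And>n. f n \<in> U"
  obtains F v where "F \<noteq> bot" "F \<le> sequentially" "v \<in> U" "(f \<longlongrightarrow> v) F"
proof -
  have "filtermap f sequentially \<noteq> bot" "\<forall>\<^sub>F y in filtermap f sequentially. y \<in> U"
    using assms(2) by (auto simp: filtermap_bot_iff eventually_filtermap)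
  then obtain v where v: "v \<in> U" "inf (nhds v) (filtermap f sequentially) \<noteq> bot"
    using assms(1) unfolding compact_filter by blast
  let ?F = "inf sequentially (filtercomap f (nhds v))"
  have "?F \<noteq> bot"
  proof
    assume "?F = bot"
    then have "eventually (\<lambda>_. False) ?F"
      by simp
    then obtain P Q where P: "eventually P sequentially" and Q: "eventually Q (nhds v)"
      and PQ: "\<And>n. P n \<Longrightarrow> Q (f n) \<Longrightarrow> False"
      unfolding eventually_inf eventually_filtercomap by blast
    have "eventually (\<lambda>y. \<not> Q y) (filtermap f sequentially)"
      unfolding eventually_filtermap using P by eventually_elim (use PQ in blast)
    with Q have "eventually (\<lambda>_. False) (inf (nhds v) (filtermap f sequentially))"
      unfolding eventually_inf by blast
    with v(2) show False
      by (simp add: eventually_False)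
  qed
  moreover have "(f \<longlongrightarrow> v) ?F"
    using filterlim_filtercomap by (rule filterlim_mono) auto
  ultimately show thesis
    using that[of ?F v] v(1) by simp
qed

lemma compact_metrizable_subsequence:
  fixes f :: "nat \<Rightarrow> 'x::topological_space"
  assumes U: "compact U" "metrizable_space (top_of_set U)" and f: "\<And>n. f n \<in> U"
  obtains r v where "strict_mono r" "v \<in> U" "(\<lambda>k. f (r k)) \<longlonglongrightarrow> v"
proof -
  obtain M d where Md: "Metric_space M d" "top_of_set U = Metric_space.mtopology M d"
    using U(2) unfolding metrizable_space_def by blast
  interpret Metric_space M d by fact
  have M: "M = U"
    using Md(2) by (metis topspace_mtopology topspace_euclidean_subtopology)
  have "compact_space mtopology"
    using U(1) Md(2) by (metis compact_space_subtopology compactin_euclidean_iff)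
  then obtain v r where "v \<in> M" "strict_mono r" "limitin mtopology (f \<circ> r) v sequentially"
    unfolding compact_space_sequentially using f M by blast
  moreover from this have "(\<lambda>k. f (r k)) \<longlonglongrightarrow> v"
    unfolding Md(2)[symmetric] limitin_subtopology by (simp add: o_def)
  ultimately show thesis
    using that M by blast
qed

section \<open>Weak integrals\<close>

lemma has_weak_integral_unique:
  assumes "has_weak_integral M h v" "has_weak_integral M h w"
  shows "v = w"
proof (rule ccontr)
  assume "v \<noteq> w"
  then obtain l :: "'b \<Rightarrow> real" where "linear l" "continuous_on UNIV l" "l v < l w"
    using continuous_functionals_separate_points by metis
  with assms show False
    unfolding has_weak_integral_def by (metis less_irrefl)
qed

text \<open>
Each point is sent to the first centre of a finite \<open>e\<close>-net in \<open>A\<close> that is close to it. The net has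
to lie in \<open>A\<close>, because the averages formed from it must lie in the convex hull of \<open>h ` A\<close>.
\<close>

lemma compact_finite_valued_approximation:
  fixes A :: "'g::metric_space set"
  assumes "compact A" "A \<noteq> {}" "0 < e"
  obtains c where "c \<in> borel \<rightarrow>\<^sub>M count_space UNIV" "finite (c ` A)" "c ` A \<subseteq> A"
    "\<And>s. s \<in> A \<Longrightarrow> dist (c s) s < e"
proof -
  have "A \<subseteq> (\<Union>x\<in>A. ball x e)"
    using assms(3) by auto
  then obtain C where C: "C \<subseteq> A" "finite C" "A \<subseteq> (\<Union>x\<in>C. ball x e)"
    using compactE_image[OF assms(1), of A "\<lambda>x. ball x e"] by auto
  obtain xs where xs: "set xs = C"
    using finite_list[OF C(2)] by blast
  let ?P = "\<lambda>s i. i < length xs \<and> dist (xs ! i) s < e"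
  define c where "c s = xs ! (LEAST i. ?P s i)" for s
  have P: "?P s (LEAST i. ?P s i)" if s: "s \<in> A" for s
  proof -
    obtain x where "x \<in> set xs" "dist x s < e"
      using subsetD[OF C(3) s] xs by auto
    then have "\<exists>i. ?P s i"
      by (metis in_set_conv_nth)
    then show ?thesis by (rule LeastI_ex)
  qed
  have "Measurable.pred borel (\<lambda>s. ?P s i)" for i
  proof -
    have "open {s. dist (xs ! i) s < e}"
      by (intro open_Collect_less continuous_intros)
    then have [measurable]: "Measurable.pred borel (\<lambda>s. dist (xs ! i) s < e)"
      by (simp add: pred_def)
    show ?thesis by measurable
  qed
  then have "(\<lambda>s. LEAST i. ?P s i) \<in> borel \<rightarrow>\<^sub>M count_space UNIV"
    by (rule measurable_Least)
  then have "c \<in> borel \<rightarrow>\<^sub>M count_space UNIV"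
    unfolding c_def by (rule measurable_compose) simp
  moreover have "c ` A \<subseteq> C"
    using P xs by (auto simp: c_def)
  moreover from this have "finite (c ` A)"
    using C(2) finite_subset by blast
  ultimately show thesis
    using that C(1) P by (auto simp: c_def)
qed

text \<open>
The barycentre \<open>v\<close> is a cluster point of the convex combinations \<open>R k\<close> of values of \<open>h\<close> that come
from finite-valued approximations \<open>c k\<close> of the identity on \<open>A\<close>. For each continuous functional
\<open>l\<close> the numbers \<open>l (R k)\<close> converge by dominated convergence, and their limit has to be
\<open>l v\<close>. Compactness of the closed convex hull replaces completeness of the space.
\<close>

lemma weak_integral_exists:
  fixes h :: "'g::metric_space \<Rightarrow> 'x::locally_convex_t2_space"
  assumes M: "finite_measure M" "sets M = sets (restrict_space borel A)" "measure M A > 0"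
    and A: "compact A" and h: "continuous_on A h"
    and hull: "compact (closure (convex hull (h ` A)))"
  obtains v where "v \<in> closure (convex hull (h ` A))"
    "has_weak_integral M h (measure M A *\<^sub>R v)"
proof -
  interpret finite_measure M by (rule M(1))
  have A_ne: "A \<noteq> {}"
    using M(3) by auto
  have space: "space M = A"
    using sets_eq_imp_space_eq[OF M(2)] by (simp add: space_restrict_space)
  define m where "m = measure M A"
  have m: "0 < m"
    using M(3) by (simp add: m_def)
  have "\<exists>c. c \<in> borel \<rightarrow>\<^sub>M count_space UNIV \<and> finite (c ` A) \<and> c ` A \<subseteq> A \<and>
      (\<forall>s\<in>A. dist (c s) s < 1 / real (Suc k))" for k
  proof -
    have "0 < 1 / real (Suc k)" by simp
    from compact_finite_valued_approximation[OF A A_ne this] show ?thesis by metis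
  qed
  then obtain c :: "nat \<Rightarrow> 'g \<Rightarrow> 'g"
    where c_meas: "\<And>k. c k \<in> borel \<rightarrow>\<^sub>M count_space UNIV" and c_fin: "\<And>k. finite (c k ` A)"
      and c_A: "\<And>k. c k ` A \<subseteq> A" and c_dist: "\<And>k s. s \<in> A \<Longrightarrow> dist (c k s) s < 1 / real (Suc k)"
    by metis
  define P where "P k a = c k -` {a} \<inter> A" for k a
  have P_sets [measurable]: "P k a \<in> sets M" for k a
  proof -
    have "c k -` {a} \<inter> space borel \<in> sets borel"
      by (rule measurable_sets[OF c_meas]) simp
    then show ?thesis
      unfolding M(2) sets_restrict_space P_def by auto
  qed
  have P_sum: "(\<Sum>a\<in>c k ` A. indicat_real (P k a) s * g a) = g (c k s)" if "s \<in> A" for k s g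
  proof -
    have "(\<Sum>a\<in>c k ` A. indicat_real (P k a) s * g a) = (\<Sum>a\<in>c k ` A. if a = c k s then g a else 0)"
      using that by (intro sum.cong) (auto simp: P_def)
    also have "\<dots> = g (c k s)"
      using c_fin that by (simp add: sum.delta)
    finally show ?thesis .
  qed
  define R where "R k = (\<Sum>a\<in>c k ` A. (measure M (P k a) / m) *\<^sub>R h a)" for k
  have step_int: "integrable M (\<lambda>s. g (c k s))"
    and step_eq: "(\<integral>s. g (c k s) \<partial>M) = (\<Sum>a\<in>c k ` A. measure M (P k a) * g a)" for k and g :: "'g \<Rightarrow> real"
  proof -
    have "integrable M (\<lambda>s. \<Sum>a\<in>c k ` A. indicat_real (P k a) s * g a)"
      by (intro Bochner_Integration.integrable_sum integrable_mult_left integrable_indicator)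
        (auto simp: emeasure_eq_measure)
    moreover have "(\<integral>s. (\<Sum>a\<in>c k ` A. indicat_real (P k a) s * g a) \<partial>M)
        = (\<Sum>a\<in>c k ` A. measure M (P k a) * g a)"
      by (subst Bochner_Integration.integral_sum)
        (auto simp: emeasure_eq_measure sets.sets_into_space[OF P_sets, THEN Int_absorb2]
          intro!: integrable_mult_left integrable_indicator)
    ultimately show "integrable M (\<lambda>s. g (c k s))"
      and "(\<integral>s. g (c k s) \<partial>M) = (\<Sum>a\<in>c k ` A. measure M (P k a) * g a)"
      using P_sum space by (auto cong: Bochner_Integration.integrable_cong Bochner_Integration.integral_cong)
  qed
  have R_hull: "R k \<in> closure (convex hull (h ` A))" for k
  proof -
    have "(\<Sum>a\<in>c k ` A. measure M (P k a)) = m"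
      using step_eq[of "\<lambda>_. 1" k] by (simp add: space m_def)
    then have "(\<Sum>a\<in>c k ` A. measure M (P k a) / m) = 1"
      using m by (simp flip: sum_divide_distrib)
    moreover have "h a \<in> convex hull (h ` A)" if "a \<in> c k ` A" for a
      using c_A that by (intro hull_inc) blast
    ultimately have "R k \<in> convex hull (h ` A)"
      unfolding R_def using m by (intro convex_sum c_fin convex_convex_hull) auto
    then show ?thesis
      using closure_subset by blast
  qed
  then obtain F v where F: "F \<noteq> bot" "F \<le> sequentially"
    and v: "v \<in> closure (convex hull (h ` A))" "(R \<longlongrightarrow> v) F"
    using compact_sequence_cluster_filter[OF hull] by metis
  have c_lim: "(\<lambda>k. c k s) \<longlonglongrightarrow> s" if "s \<in> A" for s
  proof (rule metric_tendsto_imp_tendsto)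
    show "(\<lambda>k. 1 / real (Suc k)) \<longlonglongrightarrow> 0"
      using LIMSEQ_inverse_real_of_nat by (simp add: inverse_eq_divide)
    show "\<forall>\<^sub>F k in sequentially. dist (c k s) s \<le> dist (1 / real (Suc k)) 0"
      using c_dist[OF that] by (intro always_eventually) (auto intro: less_imp_le)
  qed
  have meas: "h \<in> borel_measurable M"
    using borel_measurable_continuous_on_restrict[OF h] measurable_cong_sets[OF M(2) refl] by blast
  have "integrable M (\<lambda>s. l (h s)) \<and> l (m *\<^sub>R v) = (\<integral>s. l (h s) \<partial>M)"
    if l: "linear l" "continuous_on UNIV l" for l :: "'x \<Rightarrow> real"
  proof -
    have lh: "continuous_on A (\<lambda>s. l (h s))"
      using continuous_on_compose2[OF l(2) h] by simp
    obtain B where B: "\<And>s. s \<in> A \<Longrightarrow> norm (l (h s)) \<le> B"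
      using compact_imp_bounded[OF compact_continuous_image[OF lh A]]
      unfolding bounded_iff by auto
    have lh_meas: "(\<lambda>s. l (h s)) \<in> borel_measurable M"
      using borel_measurable_continuous_on_restrict[OF lh] measurable_cong_sets[OF M(2) refl] by blast
    have int: "integrable M (\<lambda>s. l (h s))"
      using lh_meas B space by (intro integrable_const_bound[where B = B]) auto
    have "(\<lambda>k. \<integral>s. l (h (c k s)) \<partial>M) \<longlonglongrightarrow> (\<integral>s. l (h s) \<partial>M)"
    proof (rule integral_dominated_convergence[where w = "\<lambda>_. B"])
      show "(\<lambda>s. l (h (c k s))) \<in> borel_measurable M" for k
        using step_int[of "\<lambda>a. l (h a)" k] by (rule borel_measurable_integrable)
      show "AE s in M. (\<lambda>k. l (h (c k s))) \<longlonglongrightarrow> l (h s)"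
        using c_A space by (intro AE_I2 continuous_on_tendsto_compose[OF lh c_lim] always_eventually allI) auto
      show "AE s in M. norm (l (h (c k s))) \<le> B" for k
        using c_A space by (intro AE_I2 B) auto
    qed (use lh_meas in auto)
    moreover have "(\<integral>s. l (h (c k s)) \<partial>M) = m * l (R k)" for k
      using m step_eq[of "\<lambda>a. l (h a)" k] by (simp add: R_def linear_sum[OF l(1)] linear_scale[OF l(1)] sum_distrib_left)
    ultimately have "((\<lambda>k. m * l (R k)) \<longlongrightarrow> (\<integral>s. l (h s) \<partial>M)) F"
      using F(2) by (auto intro: tendsto_mono)
    moreover have "((\<lambda>k. m * l (R k)) \<longlongrightarrow> m * l v) F"
      using continuous_on_tendsto_compose[OF l(2) v(2)] by (intro tendsto_mult_left) auto
    ultimately have "(\<integral>s. l (h s) \<partial>M) = m * l v"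
      using tendsto_unique F(1) by blast
    then show ?thesis
      using int by (simp add: linear_scale[OF l(1)])
  qed
  then have "has_weak_integral M h (m *\<^sub>R v)"
    unfolding has_weak_integral_def using meas by blast
  with v(1) show thesis
    using that by (simp add: m_def)
qed

section \<open>Averages along a F\<oslash>lner sequence\<close>

lemma haar_measureD:
  fixes \<mu> :: "'g::{topological_group_add, t2_space} measure"
  assumes "haar_measure \<mu>"
  shows "sets \<mu> = sets borel" "space \<mu> = UNIV"
    and "compact K \<Longrightarrow> K \<in> sets \<mu>" "compact K \<Longrightarrow> emeasure \<mu> K < \<infinity>"
    and "B \<in> sets \<mu> \<Longrightarrow> emeasure \<mu> ((+) \<phi> ` B) = emeasure \<mu> B"
proof -
  note defn = assms[unfolded haar_measure_def]
  show sets: "sets \<mu> = sets borel"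
    using defn by (elim conjE)
  then show "space \<mu> = UNIV"
    using sets_eq_imp_space_eq[OF sets] by simp
  show "K \<in> sets \<mu>" if "compact K"
    using compact_imp_closed[OF that] by (simp add: sets)
  show "emeasure \<mu> K < \<infinity>" if "compact K"
    using that by (rule defn[THEN conjunct2, THEN conjunct2, THEN conjunct2, THEN conjunct1, rule_format])
  show "emeasure \<mu> ((+) \<phi> ` B) = emeasure \<mu> B" if "B \<in> sets \<mu>"
    using that by (rule defn[THEN conjunct2, THEN conjunct2, THEN conjunct2, THEN conjunct2, rule_format])
qed

lemma haar_measure_distr_translation:
  fixes \<mu> :: "'g::{topological_group_add, t2_space} measure"
  assumes "haar_measure \<mu>"
  shows "(+) \<phi> \<in> \<mu> \<rightarrow>\<^sub>M \<mu>" "distr \<mu> \<mu> ((+) \<phi>) = \<mu>"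
proof -
  note haar = haar_measureD[OF assms]
  have "(+) \<phi> \<in> borel \<rightarrow>\<^sub>M borel"
    by (intro borel_measurable_continuous_onI continuous_intros)
  then show meas: "(+) \<phi> \<in> \<mu> \<rightarrow>\<^sub>M \<mu>"
    using measurable_cong_sets[OF haar(1) haar(1)] by blast
  show "distr \<mu> \<mu> ((+) \<phi>) = \<mu>"
  proof (rule measure_eqI)
    fix B assume "B \<in> sets (distr \<mu> \<mu> ((+) \<phi>))"
    then have B: "B \<in> sets \<mu>" by simp
    have "(+) \<phi> -` B = (+) (- \<phi>) ` B"
      by (force simp: image_iff add.assoc[symmetric])
    then show "emeasure (distr \<mu> \<mu> ((+) \<phi>)) B = emeasure \<mu> B"
      using emeasure_distr[OF meas B] haar(2) haar(5)[OF B, of "- \<phi>"] by simp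
  qed simp
qed

text \<open>
Translating the integrand amounts to translating the domain, so the two integrals differ only on
the symmetric difference of \<open>A\<close> and \<open>\<phi> + A\<close>. Both halves of it have the same measure, which gives
the factor 2.
\<close>

lemma haar_translated_integral_difference:
  fixes \<mu> :: "'g::{topological_group_add, t2_space} measure" and f :: "'g \<Rightarrow> real"
  assumes \<mu>: "haar_measure \<mu>" and A: "compact A"
    and f: "f \<in> borel_measurable \<mu>" "\<And>\<psi>. \<bar>f \<psi>\<bar> \<le> B"
  shows "\<bar>(\<integral>\<psi>. f (\<phi> + \<psi>) \<partial>restrict_space \<mu> A) - (\<integral>\<psi>. f \<psi> \<partial>restrict_space \<mu> A)\<bar>
           \<le> 2 * B * (measure \<mu> A - measure \<mu> (A \<inter> (+) \<phi> ` A))"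
proof -
  note haar = haar_measureD[OF \<mu>]
  let ?T = "(+) \<phi> ` A"
  have T: "compact ?T"
    using A by (intro compact_continuous_image continuous_intros)
  have sets [measurable]: "A \<in> sets \<mu>" "?T \<in> sets \<mu>"
    using haar(3) A T by auto
  have fin: "emeasure \<mu> A < \<infinity>" "emeasure \<mu> ?T < \<infinity>"
    using haar(4) A T by auto
  have "emeasure \<mu> (?T - A) \<le> emeasure \<mu> ?T" "emeasure \<mu> (A - ?T) \<le> emeasure \<mu> A"
    using sets by (auto intro!: emeasure_mono)
  then have fin_diff: "emeasure \<mu> (?T - A) < \<infinity>" "emeasure \<mu> (A - ?T) < \<infinity>"
    using fin by (metis le_less_trans)+
  have int: "integrable \<mu> (\<lambda>\<psi>. indicat_real S \<psi> * f \<psi>)" if "S = A \<or> S = ?T" for S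
    using integrableI_bounded_set_indicator[of S \<mu> f B] that sets fin f by auto
  have restr: "(\<integral>\<psi>. k \<psi> \<partial>restrict_space \<mu> A) = (\<integral>\<psi>. indicat_real A \<psi> * k \<psi> \<partial>\<mu>)" for k :: "'g \<Rightarrow> real"
    using sets by (subst integral_restrict_space) auto
  have "(\<integral>\<psi>. f (\<phi> + \<psi>) \<partial>restrict_space \<mu> A) = (\<integral>\<psi>. indicat_real ?T (\<phi> + \<psi>) * f (\<phi> + \<psi>) \<partial>\<mu>)"
    unfolding restr by (intro Bochner_Integration.integral_cong) (auto simp: indicator_def)
  also have "\<dots> = (\<integral>\<psi>. indicat_real ?T \<psi> * f \<psi> \<partial>distr \<mu> \<mu> ((+) \<phi>))"
    using haar_measure_distr_translation(1)[OF \<mu>] f(1) sets by (subst integral_distr) auto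
  finally have "(\<integral>\<psi>. f (\<phi> + \<psi>) \<partial>restrict_space \<mu> A) - (\<integral>\<psi>. f \<psi> \<partial>restrict_space \<mu> A)
      = (\<integral>\<psi>. indicat_real ?T \<psi> * f \<psi> - indicat_real A \<psi> * f \<psi> \<partial>\<mu>)"
    unfolding restr haar_measure_distr_translation(2)[OF \<mu>]
    by (subst Bochner_Integration.integral_diff) (use int in auto)
  moreover have "norm (\<integral>\<psi>. indicat_real ?T \<psi> * f \<psi> - indicat_real A \<psi> * f \<psi> \<partial>\<mu>)
      \<le> (\<integral>\<psi>. B * indicat_real (?T - A) \<psi> + B * indicat_real (A - ?T) \<psi> \<partial>\<mu>)"
  proof (rule order_trans[OF integral_norm_bound integral_mono])
    show "integrable \<mu> (\<lambda>\<psi>. norm (indicat_real ?T \<psi> * f \<psi> - indicat_real A \<psi> * f \<psi>))"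
      by (intro integrable_norm Bochner_Integration.integrable_diff int) simp_all
    show "integrable \<mu> (\<lambda>\<psi>. B * indicat_real (?T - A) \<psi> + B * indicat_real (A - ?T) \<psi>)"
      using sets fin_diff
      by (intro Bochner_Integration.integrable_add integrable_mult_right integrable_indicator) simp_all
    show "norm (indicat_real ?T \<psi> * f \<psi> - indicat_real A \<psi> * f \<psi>)
        \<le> B * indicat_real (?T - A) \<psi> + B * indicat_real (A - ?T) \<psi>" for \<psi>
      using f(2)[of \<psi>] by (auto simp: indicator_def)
  qed
  moreover have "(\<integral>\<psi>. B * indicat_real (?T - A) \<psi> + B * indicat_real (A - ?T) \<psi> \<partial>\<mu>)
      = B * measure \<mu> (?T - A) + B * measure \<mu> (A - ?T)"
  proof -
    show ?thesis
      using sets fin_diff by (subst Bochner_Integration.integral_add)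
        (auto simp: haar(2) intro!: integrable_mult_right integrable_indicator)
  qed
  moreover have "measure \<mu> (?T - A) = measure \<mu> A - measure \<mu> (A \<inter> ?T)"
  proof -
    have "measure \<mu> ?T = measure \<mu> A"
      using haar(5)[OF sets(1)] by (simp add: measure_def)
    moreover have "?T - A = ?T - (A \<inter> ?T)" by blast
    ultimately show ?thesis
      using measure_Diff[of \<mu> ?T "A \<inter> ?T"] sets fin by auto
  qed
  moreover have "measure \<mu> (A - ?T) = measure \<mu> A - measure \<mu> (A \<inter> ?T)"
  proof -
    have "A - ?T = A - (A \<inter> ?T)" by blast
    then show ?thesis
      using measure_Diff[of \<mu> A "A \<inter> ?T"] sets fin by auto
  qed
  ultimately show ?thesis
    by (simp add: algebra_simps)
qed

lemma haar_weak_integral_exists: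
  fixes \<mu> :: "'g::{topological_group_add, metric_space} measure"
  assumes \<mu>: "haar_measure \<mu>" and A: "compact A" "measure \<mu> A > 0"
    and act: "continuous_linear_action act"
    and hull: "compact (closure (convex hull ((\<lambda>\<phi>. act \<phi> x) ` A)))"
  obtains v where "v \<in> closure (convex hull ((\<lambda>\<phi>. act \<phi> x) ` A))"
    "has_weak_integral (restrict_space \<mu> A) (\<lambda>\<phi>. act \<phi> x) (measure \<mu> A *\<^sub>R v)"
proof -
  note haar = haar_measureD[OF \<mu>]
  let ?M = "restrict_space \<mu> A"
  have "finite_measure ?M"
    using haar(3)[OF A(1)] haar(4)[OF A(1)] haar(2)
    by (intro finite_measureI) (auto simp: space_restrict_space emeasure_restrict_space)
  moreover have "sets ?M = sets (restrict_space borel A)"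
    using haar(1) by (rule sets_restrict_space_cong)
  moreover have "measure ?M A = measure \<mu> A"
    using haar(3)[OF A(1)] haar(2) by (intro measure_restrict_space) auto
  ultimately show thesis
    using weak_integral_exists[of ?M A "\<lambda>\<phi>. act \<phi> x", OF _ _ _ A(1) _ hull] A(2)
      continuous_on_subset[OF continuous_linear_actionD(4)[OF act]] that by auto
qed

text \<open>
For singletons \<open>K\<close> the F\<oslash>lner condition is asymptotic invariance of \<open>A n\<close> under a single
translation, which is what the averages are sensitive to.
\<close>

lemma folner_sequenceD:
  assumes "folner_sequence \<mu> A"
  shows "compact (A n)" "measure \<mu> (A n) > 0"
    and "(\<lambda>n. measure \<mu> (A n \<inter> (+) \<phi> ` A n) / measure \<mu> (A n)) \<longlonglongrightarrow> 1"
proof -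
  note defn = assms[unfolded folner_sequence_def]
  show "compact (A n)" "measure \<mu> (A n) > 0"
    using defn[THEN conjunct1, THEN spec, of n] by simp_all
  have "{\<phi>' + \<psi> |\<phi>' \<psi>. \<phi>' \<in> {\<phi>} \<and> \<psi> \<in> A n} = (+) \<phi> ` A n" for n
    by auto
  moreover have "compact {\<phi>}" "{\<phi>} \<noteq> {}"
    by auto
  ultimately show "(\<lambda>n. measure \<mu> (A n \<inter> (+) \<phi> ` A n) / measure \<mu> (A n)) \<longlonglongrightarrow> 1"
    using defn[THEN conjunct2, THEN spec, of "{\<phi>}"] by simp
qed

lemma folner_average_props:
  fixes \<mu> :: "'g::{topological_group_add, metric_space} measure"
  assumes \<mu>: "haar_measure \<mu>" and A: "folner_sequence \<mu> A"
    and act: "continuous_linear_action act" and comp: "compact (orbitope act x)"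
  shows folner_average_in_orbitope: "folner_average \<mu> A act x n \<in> orbitope act x"
    and functional_folner_average: "\<And>l :: 'x::locally_convex_t2_space \<Rightarrow> real. linear l \<Longrightarrow>
      continuous_on UNIV l \<Longrightarrow> l (folner_average \<mu> A act x n) =
        (\<integral>\<phi>. l (act \<phi> x) \<partial>restrict_space \<mu> (A n)) / measure \<mu> (A n)"
proof -
  let ?M = "restrict_space \<mu> (A n)" and ?h = "\<lambda>\<phi>. act \<phi> x"
  have "?h ` A n \<subseteq> orbit act x"
    by (auto simp: orbit_def)
  then have sub: "closure (convex hull (?h ` A n)) \<subseteq> orbitope act x"
    unfolding orbitope_def by (intro closure_mono hull_mono)
  then have "compact (closure (convex hull (?h ` A n)))"
    using compact_Int_closed[OF comp closed_closure[of "convex hull (?h ` A n)"]]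
    by (simp add: Int_absorb1)
  from haar_weak_integral_exists[OF \<mu> folner_sequenceD(1,2)[OF A] act this]
  obtain v where v: "v \<in> closure (convex hull (?h ` A n))"
    "has_weak_integral ?M ?h (measure \<mu> (A n) *\<^sub>R v)" .
  have "weak_integral ?M ?h = measure \<mu> (A n) *\<^sub>R v"
    unfolding weak_integral_def using v(2) has_weak_integral_unique by (intro the_equality)
  then have eq: "folner_average \<mu> A act x n = v"
    using folner_sequenceD(2)[OF A, of n] by (simp add: folner_average_def)
  show "folner_average \<mu> A act x n \<in> orbitope act x"
    using v(1) sub eq by blast
  show "l (folner_average \<mu> A act x n) = (\<integral>\<phi>. l (act \<phi> x) \<partial>?M) / measure \<mu> (A n)"
    if l: "linear l" "continuous_on UNIV l" for l :: "'x \<Rightarrow> real"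
  proof -
    have "l (measure \<mu> (A n) *\<^sub>R v) = (\<integral>\<phi>. l (act \<phi> x) \<partial>?M)"
      using v(2) l unfolding has_weak_integral_def by blast
    then show ?thesis
      using folner_sequenceD(2)[OF A, of n] by (simp add: eq linear_scale[OF l(1)] field_simps)
  qed
qed

text \<open>
A functional \<open>l\<close> separating \<open>act \<phi> xbar\<close> from \<open>xbar\<close> is bounded on the compact orbitope. The
translation estimate bounds the difference of its values at \<open>act \<phi>\<close> of the \<open>n\<close>-th average and at
the \<open>n\<close>-th average by a multiple of the proportion of \<open>A n\<close> lost under translation by \<open>\<phi>\<close>. This
proportion tends to 0, so \<open>l\<close> takes the same value at \<open>act \<phi> xbar\<close> and \<open>xbar\<close>.
\<close>

lemma folner_average_limit_fixed:
  fixes \<mu> :: "'g::{topological_group_add, metric_space} measure"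
    and act :: "'g \<Rightarrow> 'x::locally_convex_t2_space \<Rightarrow> 'x"
  assumes \<mu>: "haar_measure \<mu>" and A: "folner_sequence \<mu> A"
    and act: "continuous_linear_action act" and comp: "compact (orbitope act x)"
    and F: "F \<noteq> bot" "F \<le> sequentially" and lim: "(folner_average \<mu> A act x \<longlongrightarrow> xbar) F"
  shows "xbar \<in> fixed_points act"
proof -
  have "act \<phi> xbar = xbar" for \<phi>
  proof (rule ccontr)
    assume "act \<phi> xbar \<noteq> xbar"
    then obtain l :: "'x \<Rightarrow> real" where l: "linear l" "continuous_on UNIV l" "l (act \<phi> xbar) < l xbar"
      using continuous_functionals_separate_points by metis
    note actD = continuous_linear_actionD[OF act]
    let ?v = "folner_average \<mu> A act x" and ?f = "\<lambda>\<psi>. l (act \<psi> x)"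
    have l\<phi>: "linear (\<lambda>y. l (act \<phi> y))" "continuous_on UNIV (\<lambda>y. l (act \<phi> y))"
      using linear_compose[OF actD(2) l(1)] continuous_on_compose2[OF l(2) actD(3)]
      by (simp_all add: o_def)
    obtain B where "\<And>y. y \<in> orbitope act x \<Longrightarrow> norm (l y) \<le> B"
      using compact_imp_bounded[OF compact_continuous_image[OF continuous_on_subset[OF l(2)] comp]]
      unfolding bounded_iff by auto
    then have bound: "\<bar>?f \<psi>\<bar> \<le> B" for \<psi>
      using orbit_subset_orbitope[of act x] by (auto simp: orbit_def)
    have "continuous_on UNIV ?f"
      using continuous_on_compose2[OF l(2) actD(4)] by simp
    then have meas: "?f \<in> borel_measurable \<mu>"
      using borel_measurable_continuous_onI measurable_cong_sets[OF haar_measureD(1)[OF \<mu>] refl]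
      by blast
    let ?e = "\<lambda>n. 2 * B * (1 - measure \<mu> (A n \<inter> (+) \<phi> ` A n) / measure \<mu> (A n))"
    have diff_le: "\<bar>l (act \<phi> (?v n)) - l (?v n)\<bar> \<le> ?e n" for n
    proof -
      let ?M = "restrict_space \<mu> (A n)" and ?m = "measure \<mu> (A n)"
      have m: "0 < ?m" by (rule folner_sequenceD(2)[OF A])
      have "l (act \<phi> (?v n)) - l (?v n) = ((\<integral>\<psi>. ?f (\<phi> + \<psi>) \<partial>?M) - (\<integral>\<psi>. ?f \<psi> \<partial>?M)) / ?m"
        using functional_folner_average[OF \<mu> A act comp] l l\<phi>
        by (simp add: actD(1) diff_divide_distrib)
      also have "\<bar>\<dots>\<bar> = \<bar>(\<integral>\<psi>. ?f (\<phi> + \<psi>) \<partial>?M) - (\<integral>\<psi>. ?f \<psi> \<partial>?M)\<bar> / ?m"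
        using m by simp
      also have "\<dots> \<le> 2 * B * (?m - measure \<mu> (A n \<inter> (+) \<phi> ` A n)) / ?m"
        by (rule divide_right_mono[OF haar_translated_integral_difference
              [OF \<mu> folner_sequenceD(1)[OF A] meas bound] less_imp_le[OF m]])
      also have "\<dots> = ?e n"
        using m by (simp add: field_simps)
      finally show ?thesis .
    qed
    have "?e \<longlonglongrightarrow> 2 * B * (1 - 1)"
      by (intro tendsto_intros folner_sequenceD(3)[OF A])
    then have lim_e: "?e \<longlonglongrightarrow> 0"
      by simp
    have "(\<lambda>n. l (act \<phi> (?v n)) - l (?v n)) \<longlonglongrightarrow> 0"
      by (rule Lim_null_comparison[OF always_eventually lim_e]) (simp only: real_norm_def diff_le simp_thms)
    then have "((\<lambda>n. l (act \<phi> (?v n)) - l (?v n)) \<longlongrightarrow> 0) F"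
      using F(2) tendsto_mono by blast
    moreover have "((\<lambda>n. l (act \<phi> (?v n)) - l (?v n)) \<longlongrightarrow> l (act \<phi> xbar) - l xbar) F"
      using lim by (intro tendsto_diff continuous_on_tendsto_compose[OF l(2)]
          continuous_on_tendsto_compose[OF l\<phi>(2)]) auto
    ultimately have "l (act \<phi> xbar) - l xbar = 0"
      using tendsto_unique F(1) by blast
    with l(3) show False by simp
  qed
  then show ?thesis
    unfolding fixed_points_def by blast
qed

lemma folner_average_fixed_cluster_point:
  fixes \<mu> :: "'g::{topological_group_add, metric_space} measure"
    and act :: "'g \<Rightarrow> 'x::locally_convex_t2_space \<Rightarrow> 'x"
  assumes \<mu>: "haar_measure \<mu>" and A: "folner_sequence \<mu> A"
    and act: "continuous_linear_action act" and comp: "compact (orbitope act x)"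
  obtains F xbar where "F \<noteq> bot" "F \<le> sequentially" "(folner_average \<mu> A act x \<longlongrightarrow> xbar) F"
    "xbar \<in> orbitope act x" "xbar \<in> fixed_points act"
proof -
  obtain F xbar where F: "F \<noteq> bot" "F \<le> sequentially" "(folner_average \<mu> A act x \<longlongrightarrow> xbar) F"
    and "xbar \<in> orbitope act x"
    using compact_sequence_cluster_filter[OF comp folner_average_in_orbitope[OF \<mu> A act comp]] .
  then show thesis
    using folner_average_limit_fixed[OF \<mu> A act comp F] that by simp
qed


section \<open>Invariant convex minimization\<close>

lemma orbitope_subset_invariant_set:
  fixes K :: "'x::locally_convex_t2_space set"
  assumes "closed K" "convex K" "invariant_set act K" "z \<in> K"
  shows "orbitope act z \<subseteq> K"
  unfolding orbitope_def
proof (rule closed_convex_hull_subset[OF _ assms(1,2)])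
  show "orbit act z \<subseteq> K"
    using assms(3,4) unfolding orbit_def invariant_set_def by fast
qed

text \<open>
The orbitope of \<open>z \<in> K\<close> lies in \<open>K\<close> and contains a fixed point \<open>y\<close>. As \<open>g\<close> is constant on the orbit
of \<open>z\<close>, domination by the orbit reads \<open>g y \<le> g z\<close>.
\<close>

lemma invariant_inf_eq_inf_fixed_points:
  fixes \<mu> :: "'g::{topological_group_add, metric_space} measure"
    and act :: "'g \<Rightarrow> 'x::locally_convex_t2_space \<Rightarrow> 'x"
  assumes \<mu>: "haar_measure \<mu>" and A: "folner_sequence \<mu> A" and act: "continuous_linear_action act"
    and K: "compact K" "convex K" "invariant_set act K"
    and g: "convex_lsc_on K g" "invariant_fun_on act K g"
  shows "(INF z\<in>K. g z) = (INF z\<in>K \<inter> fixed_points act. g z)"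
    and "K \<noteq> {} \<Longrightarrow> K \<inter> fixed_points act \<noteq> {}"
proof -
  have fixed: "\<exists>y\<in>K \<inter> fixed_points act. g y \<le> g z" if z: "z \<in> K" for z
  proof -
    have sub: "orbitope act z \<subseteq> K"
      by (rule orbitope_subset_invariant_set[OF compact_imp_closed[OF K(1)] K(2,3) z])
    then have "compact (orbitope act z)"
      using compact_Int_closed[OF K(1) closed_orbitope[of act z]] by (simp add: Int_absorb1)
    then obtain y where y: "y \<in> orbitope act z" "y \<in> fixed_points act"
      by (rule folner_average_fixed_cluster_point[OF \<mu> A act])
    have "g y \<le> (SUP \<phi>. g (act \<phi> z))"
      using orbitope_dominated_by_orbit[OF y(1)] convex_lsc_on_subset[OF g(1) sub]
      unfolding dominated_by_orbit_def by simp
    also have "\<dots> = g z"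
      using g(2) z by (simp add: invariant_fun_on_def)
    finally show ?thesis
      using y sub by (intro bexI[of _ y]) auto
  qed
  show "(INF z\<in>K. g z) = (INF z\<in>K \<inter> fixed_points act. g z)"
  proof (rule antisym)
    show "(INF z\<in>K. g z) \<le> (INF z\<in>K \<inter> fixed_points act. g z)"
      by (rule INF_superset_mono) auto
    show "(INF z\<in>K \<inter> fixed_points act. g z) \<le> (INF z\<in>K. g z)"
      using fixed by (rule INF_mono)
  qed
  show "K \<inter> fixed_points act \<noteq> {}" if ne: "K \<noteq> {}"
  proof -
    obtain z where "z \<in> K" using ne by fast
    from fixed[OF this] show ?thesis by fast
  qed
qed

theorem theorem6:
  fixes \<mu> :: "'g::{topological_group_add, polish_space} measure"
    and A :: "nat \<Rightarrow> 'g set"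
    and act :: "'g \<Rightarrow> 'x::locally_convex_t2_space \<Rightarrow> 'x"
    and x :: 'x
  assumes nice: "locally compact (UNIV :: 'g set)"
    and haar: "haar_measure \<mu>"
    and action: "continuous_linear_action act"
    and folner: "folner_sequence \<mu> A"
  shows
    "(\<comment> \<open>(i)\<close>
      compact (orbitope act x) \<longrightarrow>
        (\<exists>xbar \<in> orbitope act x. xbar \<in> fixed_points act \<and> dominated_by_orbit act x xbar)) \<and>
     (\<comment> \<open>(ii), existence of the integrals\<close>
      \<forall>n. compact (closure (convex hull ((\<lambda>\<phi>. act \<phi> x) ` A n))) \<longrightarrow>
        (\<exists>!v. has_weak_integral (restrict_space \<mu> (A n)) (\<lambda>\<phi>. act \<phi> x) v)) \<and>
     (\<comment> \<open>(ii), convergence along a subnet\<close>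
      compact (orbitope act x) \<longrightarrow>
        (\<exists>F xbar. F \<noteq> bot \<and> F \<le> sequentially \<and> (folner_average \<mu> A act x \<longlongrightarrow> xbar) F \<and>
           xbar \<in> orbitope act x \<and> xbar \<in> fixed_points act \<and> dominated_by_orbit act x xbar)) \<and>
     (\<comment> \<open>(ii), convergence along a subsequence\<close>
      compact (orbitope act x) \<and> metrizable_space (top_of_set (orbitope act x)) \<longrightarrow>
        (\<exists>r xbar. strict_mono r \<and> (\<lambda>k. folner_average \<mu> A act x (r k)) \<longlonglongrightarrow> xbar \<and>
           xbar \<in> orbitope act x \<and> xbar \<in> fixed_points act \<and> dominated_by_orbit act x xbar)) \<and>
     (\<comment> \<open>(iii)\<close>
      subspace (fixed_points act) \<and> closed (fixed_points act) \<and>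
      (\<forall>K. compact K \<and> convex K \<and> invariant_set act K \<longrightarrow>
         (\<forall>g. convex_lsc_on K g \<and> invariant_fun_on act K g \<longrightarrow>
            (INF z\<in>K. g z) = (INF z\<in>K \<inter> fixed_points act. g z) \<and>
            (K \<noteq> {} \<and> (\<exists>L::'x \<Rightarrow> real. linear L \<and> (\<forall>z\<in>K. g z = ereal (L z))) \<longrightarrow>
               (\<exists>z. z extreme_point_of K \<and> g z = (INF z\<in>K. g z)) \<and>
               (\<exists>z. z extreme_point_of (K \<inter> fixed_points act) \<and>
                    g z = (INF z\<in>K \<inter> fixed_points act. g z))))))"
proof -
  note average = folner_average_in_orbitope[OF haar folner action]
  have existence: "\<exists>xbar\<in>orbitope act x. xbar \<in> fixed_points act \<and> dominated_by_orbit act x xbar"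
    if comp: "compact (orbitope act x)"
  proof -
    obtain xbar where "xbar \<in> orbitope act x" "xbar \<in> fixed_points act"
      using folner_average_fixed_cluster_point[OF haar folner action comp] .
    then show ?thesis
      using orbitope_dominated_by_orbit by (intro bexI[of _ xbar] conjI)
  qed
  have integrals: "\<exists>!v. has_weak_integral (restrict_space \<mu> (A n)) (\<lambda>\<phi>. act \<phi> x) v"
    if comp: "compact (closure (convex hull ((\<lambda>\<phi>. act \<phi> x) ` A n)))" for n
  proof -
    obtain v where v: "has_weak_integral (restrict_space \<mu> (A n)) (\<lambda>\<phi>. act \<phi> x) (measure \<mu> (A n) *\<^sub>R v)"
      using haar_weak_integral_exists[OF haar folner_sequenceD(1,2)[OF folner] action comp] .
    show ?thesis
      using v by (rule ex1I) (rule has_weak_integral_unique[OF _ v])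
  qed
  have subnet: "\<exists>F xbar. F \<noteq> bot \<and> F \<le> sequentially \<and> (folner_average \<mu> A act x \<longlongrightarrow> xbar) F \<and>
      xbar \<in> orbitope act x \<and> xbar \<in> fixed_points act \<and> dominated_by_orbit act x xbar"
    if comp: "compact (orbitope act x)"
  proof -
    obtain F xbar where "F \<noteq> bot" "F \<le> sequentially" "(folner_average \<mu> A act x \<longlongrightarrow> xbar) F"
      "xbar \<in> orbitope act x" "xbar \<in> fixed_points act"
      using folner_average_fixed_cluster_point[OF haar folner action comp] .
    then show ?thesis
      using orbitope_dominated_by_orbit by (intro exI[of _ F] exI[of _ xbar] conjI)
  qed
  have subsequence: "\<exists>r xbar. strict_mono r \<and> (\<lambda>k. folner_average \<mu> A act x (r k)) \<longlonglongrightarrow> xbar \<and>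
      xbar \<in> orbitope act x \<and> xbar \<in> fixed_points act \<and> dominated_by_orbit act x xbar"
    if comp: "compact (orbitope act x)" and metr: "metrizable_space (top_of_set (orbitope act x))"
  proof -
    obtain r xbar where r: "strict_mono r" and xbar: "xbar \<in> orbitope act x"
      and lim: "(\<lambda>k. folner_average \<mu> A act x (r k)) \<longlonglongrightarrow> xbar"
      using compact_metrizable_subsequence[OF comp metr average[OF comp]] .
    have "xbar \<in> fixed_points act"
    proof (rule folner_average_limit_fixed[OF haar folner action comp])
      show "filtermap r sequentially \<noteq> bot"
        by (simp add: filtermap_bot_iff)
      show "filtermap r sequentially \<le> sequentially"
        using filterlim_subseq[OF r] by (simp add: filterlim_def)
      show "(folner_average \<mu> A act x \<longlongrightarrow> xbar) (filtermap r sequentially)"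
        using lim by (simp add: filterlim_filtermap)
    qed
    then show ?thesis
      using r lim xbar orbitope_dominated_by_orbit[OF xbar]
      by (intro exI[of _ r] exI[of _ xbar] conjI)
  qed
  note fixed = subspace_closed_fixed_points[OF action]
  have minimization: "(INF z\<in>K. g z) = (INF z\<in>K \<inter> fixed_points act. g z) \<and>
      (K \<noteq> {} \<and> (\<exists>L::'x \<Rightarrow> real. linear L \<and> (\<forall>z\<in>K. g z = ereal (L z))) \<longrightarrow>
        (\<exists>z. z extreme_point_of K \<and> g z = (INF z\<in>K. g z)) \<and>
        (\<exists>z. z extreme_point_of (K \<inter> fixed_points act) \<and>
           g z = (INF z\<in>K \<inter> fixed_points act. g z)))"
    if K: "compact K" "convex K" "invariant_set act K"
      and g: "convex_lsc_on K g" "invariant_fun_on act K g" for K g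
  proof (intro conjI impI)
    note inf = invariant_inf_eq_inf_fixed_points[OF haar folner action K g]
    show "(INF z\<in>K. g z) = (INF z\<in>K \<inter> fixed_points act. g z)"
      by (rule inf(1))
    assume "K \<noteq> {} \<and> (\<exists>L::'x \<Rightarrow> real. linear L \<and> (\<forall>z\<in>K. g z = ereal (L z)))"
    then obtain L :: "'x \<Rightarrow> real" where ne: "K \<noteq> {}" and L: "linear L" "\<forall>z\<in>K. g z = ereal (L z)"
      by (elim conjE exE)
    show "\<exists>z. z extreme_point_of K \<and> g z = (INF z\<in>K. g z)"
      using linear_lsc_inf_attained_at_extreme_point[OF K(1,2) ne g(1) L(1)] L(2) by metis
    have "compact (K \<inter> fixed_points act)" "convex (K \<inter> fixed_points act)"
      using K(1,2) fixed by (auto intro: compact_Int_closed convex_Int subspace_imp_convex)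
    from linear_lsc_inf_attained_at_extreme_point[OF this inf(2)[OF ne] convex_lsc_on_subset[OF g(1)] L(1)]
    show "\<exists>z. z extreme_point_of (K \<inter> fixed_points act) \<and>
        g z = (INF z\<in>K \<inter> fixed_points act. g z)"
      using L(2) by (metis Int_iff inf_le1)
  qed
  show ?thesis
    by (intro conjI fixed; intro impI allI; (elim conjE)?;
        rule existence integrals subnet subsequence minimization; assumption)
qed

end
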